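(* Let $X_1=\mathbb{R}^6_{\ge0}$ with coordinates $x,y,z,u,v,w$, and let $G$ be the group of coordinate permutations generated by $(u\ v)(y\ z)$, $(v\ w)(x\ y)$ and $(v\ x)(w\ y)$ (so $G\cong\mathrm{Sym}(4)$), with quotient map $q:X_1\to\mathbb{M}_{K_4}=X_1/G$. Let $P=\{(x,y,z,u,v,w)\in X_1:\max\{x,y\}\le u,\ \max\{x,z\}\le v,\ \max\{y,z\}\le w\}$ (the honeycomb cone), $P'=\bigcup_{g\in G}gP$ its $G$-sweep, and $\mathbb{M}^{\mathrm{pl}}_{K_4}=q(P')$. Consider the stacky fan structure on $\mathbb{M}^{\mathrm{pl}}_{K_4}$ obtained from the fundamental domain $D=P\cap\{u\ge v\ge w\}$ by identifying faces of $D$ whose $G$-orbits intersect. Then this stacky fan has face vector $(7,18,25,21,8)$ (numbers of cells of dimensions $1,2,3,4,5$), and its link $q(P'\cap\{x+y+z+u+v+w=1\})$ has trivial (reduced integral) homology.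
   Context: $\mathbb{M}_{K_4}$ is the moduli cell of genus 3 tropical curves whose underlying graph is the complete graph $K_4$ with edge lengths $x,y,z,u,v,w$, and $\mathbb{M}^{\mathrm{pl}}_{K_4}$ is the locus of tropical honeycomb curves (tropically smooth plane $K_4$-curves and their closure). The link of a stacky fan is the image of its intersection with the hyperplane where the coordinates sum to 1. *)

theory Defs
  imports "HOL-Analysis.Analysis" "HOL-Homology.Homology" "HOL-Combinatorics.Transposition"
begin

text \<open>Coordinates of R^6 = real^6: x = 1, y = 2, z = 3, u = 4, v = 5, w = 6 (index type 6).\<close>

definition genA :: "6 \<Rightarrow> 6" where
  "genA = Transposition.transpose 4 5 \<circ> Transposition.transpose 2 3"
definition genB :: "6 \<Rightarrow> 6" where
  "genB = Transposition.transpose 5 6 \<circ> Transposition.transpose 1 2"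
definition genC :: "6 \<Rightarrow> 6" where
  "genC = Transposition.transpose 5 1 \<circ> Transposition.transpose 6 2"

text \<open>The group G of coordinate permutations generated by genA, genB, genC
  (finite, so closure under composition with generators gives the generated group).\<close>
inductive_set permG :: "(6 \<Rightarrow> 6) set" where
  id_in: "id \<in> permG"
| stepA: "g \<in> permG \<Longrightarrow> genA \<circ> g \<in> permG"
| stepB: "g \<in> permG \<Longrightarrow> genB \<circ> g \<in> permG"
| stepC: "g \<in> permG \<Longrightarrow> genC \<circ> g \<in> permG"

definition act :: "(6 \<Rightarrow> 6) \<Rightarrow> real^6 \<Rightarrow> real^6" where
  "act \<sigma> p = (\<chi> i. p $ \<sigma> i)"

definition X1 :: "(real^6) set" where
  "X1 = {p. \<forall>i. 0 \<le> p $ i}"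

definition honeycombP :: "(real^6) set" where
  "honeycombP = {p \<in> X1. max (p$1) (p$2) \<le> p$4 \<and> max (p$1) (p$3) \<le> p$5
                          \<and> max (p$2) (p$3) \<le> p$6}"

definition sweepP :: "(real^6) set" where
  "sweepP = (\<Union>g\<in>permG. act g ` honeycombP)"

definition fundD :: "(real^6) set" where
  "fundD = honeycombP \<inter> {p. p$4 \<ge> p$5 \<and> p$5 \<ge> p$6}"

definition face_ident :: "((real^6) set \<times> (real^6) set) set" where
  "face_ident = {(A, B) | A B :: (real^6) set. (A face_of fundD) \<and> (B face_of fundD) \<and>
                   (\<exists>g\<in>permG. \<exists>h\<in>permG. act g ` A = act h ` B)}"

definition faces_of_dim :: "nat \<Rightarrow> (real^6) set set" where
  "faces_of_dim d = {A. A face_of fundD \<and> aff_dim A = int d}"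

definition num_cells :: "nat \<Rightarrow> nat" where
  "num_cells d = card (faces_of_dim d // face_ident)"

definition quotient_topology :: "'a topology \<Rightarrow> ('a \<Rightarrow> 'b) \<Rightarrow> 'b topology" where
  "quotient_topology X f =
     topology (\<lambda>U. U \<subseteq> f ` topspace X \<and> openin X {x \<in> topspace X. f x \<in> U})"

definition orbitG :: "real^6 \<Rightarrow> (real^6) set" where
  "orbitG p = {act g p | g. g \<in> permG}"

definition link_space :: "(real^6) set topology" where
  "link_space = quotient_topology
     (subtopology euclidean (sweepP \<inter> {p. (\<Sum>i\<in>UNIV. p $ i) = 1})) orbitG"

end

theory Submission
  imports Defs
begin

text \<open>The defining inequalities of the fundamental domain compare two coordinates, or a coordinate with
  zero. Hence a nonnegative point lies in a face exactly if all its superlevel sets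
  \<open>{i. t \<le> p i}\<close>, \<open>t > 0\<close>, do, and a face is encoded by a finite family of \<open>0/1\<close> vectors on which \<open>G\<close>
  acts by permuting entries. The dimension is the length of a maximal chain in the family.
  A symmetric function of the four triangle sums of the family turns out to separate the
  orbits of faces. The link is contractible because the sweep is star-shaped about the \<open>G\<close>-fixed ray
  through \<open>(1, \<dots>, 1)\<close>.\<close>

section \<open>Faces of polyhedral cones\<close>

lemma exhaust_6: "x = 1 \<or> x = 2 \<or> x = 3 \<or> x = 4 \<or> x = 5 \<or> x = 6" for x :: 6
proof (induct x)
  case (of_int z)
  then have "z = 0 \<or> z = 1 \<or> z = 2 \<or> z = 3 \<or> z = 4 \<or> z = 5"
    by (simp, arith)
  then show ?case
    by auto
qed

lemma forall_6: "(\<forall>i::6. P i) \<longleftrightarrow> P 1 \<and> P 2 \<and> P 3 \<and> P 4 \<and> P 5 \<and> P 6"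
  by (metis exhaust_6)

text \<open>Each inequality that is not identically tight on \<open>A\<close> is strict at a
  relative interior point \<open>c\<close>. If \<open>p\<close> satisfies the tight ones, the
  segment from \<open>p\<close> to \<open>c\<close> can be prolonged a little beyond
  \<open>c\<close> inside the cone, so the face property puts \<open>p\<close> in
  \<open>A\<close>.\<close>

lemma face_of_cone_eq:
  fixes f :: "'k \<Rightarrow> 'a::euclidean_space \<Rightarrow> real"
  assumes K: "finite K" and lin: "\<And>k. k \<in> K \<Longrightarrow> linear (f k)"
    and A: "A face_of {p. \<forall>k\<in>K. 0 \<le> f k p}" "A \<noteq> {}"
  shows "A = {p. (\<forall>k\<in>K. 0 \<le> f k p) \<and> (\<forall>k\<in>K. (\<forall>a\<in>A. f k a = 0) \<longrightarrow> f k p = 0)}"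
proof
  show "A \<subseteq> {p. (\<forall>k\<in>K. 0 \<le> f k p) \<and> (\<forall>k\<in>K. (\<forall>a\<in>A. f k a = 0) \<longrightarrow> f k p = 0)}"
    using face_of_imp_subset[OF A(1)] by auto
next
  have AD: "0 \<le> f k a" if "a \<in> A" "k \<in> K" for a k
    using face_of_imp_subset[OF A(1)] that by auto
  have "convex A"
    using A(1) by (rule face_of_imp_convex)
  then obtain c where c: "c \<in> rel_interior A"
    using A(2) rel_interior_eq_empty by blast
  then have "c \<in> A"
    using rel_interior_subset by blast
  have pos: "0 < f k c" if k: "k \<in> K" and a: "a \<in> A" "f k a \<noteq> 0" for k a
  proof -
    \<comment> \<open>The segment from \<open>a\<close> to \<open>c\<close> is prolonged beyond
      \<open>c\<close> within \<open>A\<close>; nonnegativity at the new endpoint forces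
      \<open>f k c\<close> to be positive.\<close>
    obtain e where e: "e > 1" "(1 - e) *\<^sub>R a + e *\<^sub>R c \<in> A"
      using c convex_rel_interior_iff[OF \<open>convex A\<close> A(2), of c] a(1) by blast
    have "0 \<le> (1 - e) * f k a + e * f k c"
      using AD[OF e(2) k] by (simp add: linear_add[OF lin[OF k]] linear_scale[OF lin[OF k]])
    moreover have "0 < (e - 1) * f k a"
      using AD[OF a(1) k] a(2) e(1) by simp
    ultimately have "0 < e * f k c"
      by (simp add: algebra_simps)
    then show ?thesis
      using e(1) by (simp add: zero_less_mult_iff)
  qed
  show "{p. (\<forall>k\<in>K. 0 \<le> f k p) \<and> (\<forall>k\<in>K. (\<forall>a\<in>A. f k a = 0) \<longrightarrow> f k p = 0)} \<subseteq> A"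
  proof clarify
    fix p assume p: "\<forall>k\<in>K. 0 \<le> f k p" "\<forall>k\<in>K. (\<forall>a\<in>A. f k a = 0) \<longrightarrow> f k p = 0"
    \<comment> \<open>If \<open>f k\<close> vanishes on \<open>A\<close>, both sides are 0;
      otherwise the right side is positive while the left tends to 0. Finiteness of \<open>K\<close>
      then gives one \<open>e\<close> for all constraints.\<close>
    have "\<forall>\<^sub>F e in at_right 0. e * f k p \<le> f k c" if k: "k \<in> K" for k
    proof (cases "\<forall>a\<in>A. f k a = 0")
      case True
      then show ?thesis
        using p(2) k \<open>c \<in> A\<close> by simp
    next
      case False
      then have "0 < f k c"
        using pos k by blast
      moreover have "((\<lambda>e. e * f k p) \<longlongrightarrow> 0 * f k p) (at_right 0)"
        by (intro tendsto_intros)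
      ultimately have "\<forall>\<^sub>F e in at_right 0. e * f k p < f k c"
        by (intro order_tendstoD(2)) auto
      then show ?thesis
        by eventually_elim simp
    qed
    then have "\<forall>\<^sub>F e in at_right 0. \<forall>k\<in>K. e * f k p \<le> f k c"
      using K by (simp add: eventually_ball_finite)
    moreover have "\<forall>\<^sub>F e in at_right (0::real). 0 < e"
      by (simp add: eventually_at_right_less)
    ultimately have "\<forall>\<^sub>F e in at_right 0. 0 < e \<and> (\<forall>k\<in>K. e * f k p \<le> f k c)"
      by eventually_elim simp
    from eventually_happens'[OF trivial_limit_at_right_real this]
    obtain e where e: "0 < e" "\<And>k. k \<in> K \<Longrightarrow> e * f k p \<le> f k c"
      by blast
    \<comment> \<open>The point \<open>c\<close> divides the segment from \<open>p\<close> to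
      \<open>d\<close> with weight \<open>1 / (1 + e)\<close> at \<open>d\<close>.\<close>
    define d where "d = c + e *\<^sub>R (c - p)"
    have D: "0 \<le> f k d" if k: "k \<in> K" for k
    proof -
      have "f k d = (f k c - e * f k p) + e * f k c"
        unfolding d_def
        by (simp add: linear_add[OF lin[OF k]] linear_scale[OF lin[OF k]] linear_diff[OF lin[OF k]] algebra_simps)
      then show ?thesis
        using e(2)[OF k] AD[OF \<open>c \<in> A\<close> k] e(1) by simp
    qed
    show "p \<in> A"
    proof (cases "p = c")
      case False
      have "(1 + e) *\<^sub>R c = e *\<^sub>R p + d"
        unfolding d_def by (simp add: algebra_simps)
      then have "(1 / (1 + e)) *\<^sub>R (1 + e) *\<^sub>R c = (1 / (1 + e)) *\<^sub>R (e *\<^sub>R p + d)"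
        by simp
      moreover have "1 - 1 / (1 + e) = (1 / (1 + e)) * e"
        using e(1) by (simp add: field_simps)
      ultimately have "c = (1 - 1 / (1 + e)) *\<^sub>R p + (1 / (1 + e)) *\<^sub>R d"
        using e(1) by (simp add: scaleR_add_right)
      moreover have "p \<noteq> d"
      proof
        assume "p = d"
        then have "(1 + e) *\<^sub>R (c - p) = 0"
          unfolding d_def by (simp add: algebra_simps)
        then show False
          using False e(1) by simp
      qed
      ultimately have "c \<in> open_segment p d"
        using e(1) unfolding in_segment by (intro conjI exI[of _ "1 / (1 + e)"]) auto
      then show ?thesis
        using A(1) p(1) D \<open>c \<in> A\<close> unfolding face_of_def by blast
    qed (use \<open>c \<in> A\<close> in simp)
  qed
qed

text \<open>A linear function that is nonnegative at both ends of a segment and vanishes somewhere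
  in between vanishes at both ends.\<close>

lemma face_of_cone_tight:
  fixes f :: "'k \<Rightarrow> 'a::euclidean_space \<Rightarrow> real"
  assumes lin: "\<And>k. k \<in> K \<Longrightarrow> linear (f k)" and IK: "I \<subseteq> K"
  shows "{p. (\<forall>k\<in>K. 0 \<le> f k p) \<and> (\<forall>k\<in>I. f k p = 0)} face_of {p. \<forall>k\<in>K. 0 \<le> f k p}"
proof -
  have cv: "convex {p. (\<forall>k\<in>K. 0 \<le> f k p) \<and> (\<forall>k\<in>I. f k p = 0)}"
    using IK by (auto simp: convex_def linear_add[OF lin] linear_scale[OF lin] subset_iff)
  have "f k a = 0 \<and> f k b = 0"
    if k: "k \<in> I" and x: "f k x = 0" "x \<in> open_segment a b" and ab: "0 \<le> f k a" "0 \<le> f k b" for k a b x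
  proof -
    obtain u where u: "0 < u" "u < 1" "x = (1 - u) *\<^sub>R a + u *\<^sub>R b"
      using x(2) by (auto simp: in_segment)
    have "(1 - u) * f k a + u * f k b = 0"
      using x(1) k IK unfolding u(3) by (simp add: linear_add[OF lin] linear_scale[OF lin] subset_iff)
    moreover have "0 \<le> (1 - u) * f k a" "0 \<le> u * f k b"
      using u ab by auto
    ultimately have "(1 - u) * f k a = 0 \<and> u * f k b = 0"
      by linarith
    then show ?thesis
      using u by simp
  qed
  note zero = this
  show ?thesis
    unfolding face_of_def
  proof (intro conjI ballI impI)
    fix a b x
    assume a: "a \<in> {p. \<forall>k\<in>K. 0 \<le> f k p}" and b: "b \<in> {p. \<forall>k\<in>K. 0 \<le> f k p}"
      and x: "x \<in> {p. (\<forall>k\<in>K. 0 \<le> f k p) \<and> (\<forall>k\<in>I. f k p = 0)}" "x \<in> open_segment a b"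
    have "f k a = 0 \<and> f k b = 0" if "k \<in> I" for k
      using zero[OF that _ x(2)] a b x(1) that IK by blast
    then show "a \<in> {p. (\<forall>k\<in>K. 0 \<le> f k p) \<and> (\<forall>k\<in>I. f k p = 0)}"
      and "b \<in> {p. (\<forall>k\<in>K. 0 \<le> f k p) \<and> (\<forall>k\<in>I. f k p = 0)}"
      using a b by auto
  qed (use cv in auto)
qed

section \<open>Faces of the fundamental domain\<close>

text \<open>Subsets of the six coordinates, in the order x, y, z, u, v, w, in a form that
  \<open>code_simp\<close> can evaluate.\<close>

type_synonym level = "bool \<times> bool \<times> bool \<times> bool \<times> bool \<times> bool"

definition level_at :: "real^6 \<Rightarrow> real \<Rightarrow> level" where
  "level_at p t = (t \<le> p$1, t \<le> p$2, t \<le> p$3, t \<le> p$4, t \<le> p$5, t \<le> p$6)"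

text \<open>Thresholds are positive because at \<open>t \<le> 0\<close> every point of
  \<open>X1\<close> has the full tuple. Large \<open>t\<close> give \<open>no_level\<close>, so the
  cone is empty unless \<open>L\<close> contains it.\<close>

definition level_cone :: "level set \<Rightarrow> (real^6) set" where
  "level_cone L = {p \<in> X1. \<forall>t>0. level_at p t \<in> L}"

definition no_level :: level where
  "no_level = (False, False, False, False, False, False)"

definition ray :: "level \<Rightarrow> real^6" where
  "ray = (\<lambda>(x, y, z, u, v, w). \<chi> i. of_bool (if i = 1 then x else if i = 2 then y
     else if i = 3 then z else if i = 4 then u else if i = 5 then v else w))"
lemma ray_nth: "ray (x, y, z, u, v, w) $ 1 = of_bool x"
  "ray (x, y, z, u, v, w) $ 2 = of_bool y"
  "ray (x, y, z, u, v, w) $ 3 = of_bool z"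
  "ray (x, y, z, u, v, w) $ 4 = of_bool u"
  "ray (x, y, z, u, v, w) $ 5 = of_bool v"
  "ray (x, y, z, u, v, w) $ 6 = of_bool w"
  by (simp_all only: ray_def prod.case vec_lambda_beta, simp_all)

text \<open>The positive superlevel sets of a 0/1 vector are \<open>r\<close> itself, for
  \<open>t \<le> 1\<close>, and the empty set. Hence a cone determines its family through the 0/1
  vectors it contains.\<close>

lemma ray_in_level_cone_iff:
  assumes "no_level \<in> L"
  shows "ray r \<in> level_cone L \<longleftrightarrow> r \<in> L"
proof -
  have "t \<le> of_bool P \<longleftrightarrow> P \<and> t \<le> 1" if "t > 0" for P and t :: real
    using that by (cases P) simp_all
  then have "level_at (ray r) t = (if t \<le> 1 then r else no_level)" if "t > 0" for t
    using that by (cases r) (simp add: level_at_def ray_nth no_level_def)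
  moreover have "ray r \<in> X1"
    by (cases r) (simp add: ray_nth X1_def forall_6)
  ultimately show ?thesis
    using assms by (auto simp: level_cone_def intro: exI[of _ 1])
qed

lemma level_cone_mono: "L \<subseteq> M \<Longrightarrow> level_cone L \<subseteq> level_cone M"
  by (auto simp: level_cone_def)

lemma level_cone_subset_iff:
  assumes "no_level \<in> L" "no_level \<in> M"
  shows "level_cone L \<subseteq> level_cone M \<longleftrightarrow> L \<subseteq> M"
proof
  assume *: "level_cone L \<subseteq> level_cone M"
  show "L \<subseteq> M"
  proof
    fix r assume "r \<in> L"
    then have "ray r \<in> level_cone M"
      using * ray_in_level_cone_iff[OF assms(1), of r] by blast
    then show "r \<in> M"
      using ray_in_level_cone_iff[OF assms(2)] by blast
  qed
qed (rule level_cone_mono)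

lemma level_cone_eq_iff:
  assumes "no_level \<in> L" "no_level \<in> M"
  shows "level_cone L = level_cone M \<longleftrightarrow> L = M"
  by (simp add: set_eq_subset level_cone_subset_iff assms)

text \<open>The bounds x, y, z \<ge> 0 and the cover relations of the coordinate order; transitivity
  yields the other inequalities of \<open>fundD\<close>.\<close>

datatype facet = X0 | Y0 | Z0 | XV | YW | ZW | WV | UV

fun slack :: "facet \<Rightarrow> real^6 \<Rightarrow> real" where
  "slack X0 p = p$1"
| "slack Y0 p = p$2"
| "slack Z0 p = p$3"
| "slack XV p = p$5 - p$1"
| "slack YW p = p$6 - p$2"
| "slack ZW p = p$6 - p$3"
| "slack WV p = p$5 - p$6"
| "slack UV p = p$4 - p$5"

text \<open>The counterpart of \<open>slack k p = 0\<close> at a single threshold. Within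
  \<open>levels\<close> one implication between the two coordinates always holds, so equality
  amounts to the converse one.\<close>

fun tight :: "facet \<Rightarrow> level \<Rightarrow> bool" where
  "tight X0 (x, y, z, u, v, w) = (\<not> x)"
| "tight Y0 (x, y, z, u, v, w) = (\<not> y)"
| "tight Z0 (x, y, z, u, v, w) = (\<not> z)"
| "tight XV (x, y, z, u, v, w) = (v \<longrightarrow> x)"
| "tight YW (x, y, z, u, v, w) = (w \<longrightarrow> y)"
| "tight ZW (x, y, z, u, v, w) = (w \<longrightarrow> z)"
| "tight WV (x, y, z, u, v, w) = (v \<longrightarrow> w)"
| "tight UV (x, y, z, u, v, w) = (u \<longrightarrow> v)"

lemma linear_slack: "linear (slack k)"
  by (cases k; rule linearI; simp add: algebra_simps)

lemma all_facet_iff: "(\<forall>k. P k) \<longleftrightarrow> P X0 \<and> P Y0 \<and> P Z0 \<and> P XV \<and> P YW \<and> P ZW \<and> P WV \<and> P UV"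
  (is "_ \<longleftrightarrow> ?R")
proof
  assume ?R
  then have "P k" for k
    by (cases k) simp_all
  then show "\<forall>k. P k"
    by blast
qed simp

lemma fundD_eq_slack: "fundD = {p. \<forall>k\<in>UNIV. 0 \<le> slack k p}"
proof -
  have "p \<in> fundD \<longleftrightarrow> (\<forall>k. 0 \<le> slack k p)" for p
    unfolding all_facet_iff fundD_def honeycombP_def X1_def forall_6
    by (simp, argo)
  then show ?thesis
    by auto
qed

text \<open>The upper sets of the order \<open>y, z \<le> w \<le> v \<le> u\<close>, \<open>x \<le> v\<close>; the nonempty ones span the rays of
  \<open>fundD\<close>. They are listed by increasing size because \<open>height\<close> below relies on that.\<close>

definition levels :: "level list" where
  "levels =
    [(False, False, False, False, False, False), (False, False, False, True, False, False),
     (False, False, False, True, True, False), (True, False, False, True, True, False),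
     (False, False, False, True, True, True), (True, False, False, True, True, True),
     (False, True, False, True, True, True), (False, False, True, True, True, True),
     (True, True, False, True, True, True), (True, False, True, True, True, True),
     (False, True, True, True, True, True), (True, True, True, True, True, True)]"

definition face_levels :: "facet list \<Rightarrow> level list" where
  "face_levels ks = filter (\<lambda>r. list_all (\<lambda>k. tight k r) ks) levels"

lemma mem_levels_iff:
  "(x, y, z, u, v, w) \<in> set levels \<longleftrightarrow> (y \<longrightarrow> w) \<and> (z \<longrightarrow> w) \<and> (x \<longrightarrow> v) \<and> (w \<longrightarrow> v) \<and> (v \<longrightarrow> u)"
  by (cases x; cases y; cases z; cases u; cases v; cases w; simp add: levels_def)

lemma mem_face_levels_iff: "r \<in> set (face_levels ks) \<longleftrightarrow> r \<in> set levels \<and> (\<forall>k\<in>set ks. tight k r)"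
  by (auto simp: face_levels_def list_all_iff)

lemma filter_in_subseqs: "filter P xs \<in> set (subseqs xs)"
  by (induction xs) (auto simp: Let_def)

lemma levels_le_iff: "(\<forall>t>0. t \<le> b \<longrightarrow> t \<le> a) \<longleftrightarrow> b \<le> a" if "0 \<le> a" for a b :: real
proof
  assume *: "\<forall>t>0. t \<le> b \<longrightarrow> t \<le> a"
  show "b \<le> a"
  proof (cases "0 < b")
    case True
    with * show ?thesis
      by blast
  qed (use that in simp)
qed auto

lemma levels_zero_iff: "(\<forall>t>0. \<not> t \<le> b) \<longleftrightarrow> b = 0" if "0 \<le> b" for b :: real
  using that by (cases "0 < b") auto

lemma fundD_eq_level_cone: "fundD = level_cone (set levels)"
proof -
  have "p \<in> fundD \<longleftrightarrow> p \<in> level_cone (set levels)" for p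
  proof (cases "p \<in> X1")
    case True
    then have nn: "0 \<le> p$1" "0 \<le> p$2" "0 \<le> p$3" "0 \<le> p$4" "0 \<le> p$5" "0 \<le> p$6"
      by (auto simp: X1_def)
    have "p \<in> level_cone (set levels) \<longleftrightarrow>
        (\<forall>t>0. t \<le> p$2 \<longrightarrow> t \<le> p$6) \<and> (\<forall>t>0. t \<le> p$3 \<longrightarrow> t \<le> p$6) \<and> (\<forall>t>0. t \<le> p$1 \<longrightarrow> t \<le> p$5)
        \<and> (\<forall>t>0. t \<le> p$6 \<longrightarrow> t \<le> p$5) \<and> (\<forall>t>0. t \<le> p$5 \<longrightarrow> t \<le> p$4)"
      unfolding level_cone_def level_at_def mem_levels_iff using True by blast
    also have "\<dots> \<longleftrightarrow> p$2 \<le> p$6 \<and> p$3 \<le> p$6 \<and> p$1 \<le> p$5 \<and> p$6 \<le> p$5 \<and> p$5 \<le> p$4"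
      using nn by (simp only: levels_le_iff)
    also have "\<dots> \<longleftrightarrow> p \<in> fundD"
      using True by (auto simp: fundD_def honeycombP_def)
    finally show ?thesis
      by simp
  qed (auto simp: fundD_def honeycombP_def level_cone_def)
  then show ?thesis
    by blast
qed

text \<open>Slacks are nonnegative on \<open>fundD\<close>, so vanishing is one reverse inequality
  between coordinates, or with zero, and can be tested threshold by threshold.\<close>

lemma slack_eq_0_iff:
  assumes "p \<in> fundD"
  shows "slack k p = 0 \<longleftrightarrow> (\<forall>t>0. tight k (level_at p t))"
proof -
  have "\<forall>k. 0 \<le> slack k p"
    using assms by (simp add: fundD_eq_slack)
  then have le: "0 \<le> slack k p" for k
    by blast
  have "\<forall>i. 0 \<le> p $ i"
    using assms by (simp add: fundD_def honeycombP_def X1_def)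
  then have nn: "0 \<le> p $ i" for i
    by blast
  show ?thesis
    using le[of k] nn by (cases k) (auto simp: level_at_def levels_le_iff levels_zero_iff)
qed

lemma level_cone_face_levels:
  "level_cone (set (face_levels ks)) = {p. (\<forall>k\<in>UNIV. 0 \<le> slack k p) \<and> (\<forall>k\<in>set ks. slack k p = 0)}"
proof -
  have "level_cone (set (face_levels ks)) = {p \<in> fundD. \<forall>k\<in>set ks. \<forall>t>0. tight k (level_at p t)}"
    unfolding fundD_eq_level_cone by (auto simp: level_cone_def mem_face_levels_iff)
  also have "\<dots> = {p \<in> fundD. \<forall>k\<in>set ks. slack k p = 0}"
    using slack_eq_0_iff by blast
  finally show ?thesis
    by (simp add: fundD_eq_slack)
qed

lemma no_level_mem_face_levels: "no_level \<in> set (face_levels ks)"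
proof -
  have "tight k no_level" for k
    by (cases k) (simp_all add: no_level_def)
  then show ?thesis
    by (simp add: mem_face_levels_iff no_level_def mem_levels_iff)
qed

lemma level_cone_face_of_fundD: "level_cone (set (face_levels ks)) face_of fundD"
  unfolding fundD_eq_slack level_cone_face_levels
  by (rule face_of_cone_tight) (auto intro: linear_slack)

definition facets :: "facet list" where
  "facets = [X0, Y0, Z0, XV, YW, ZW, WV, UV]"

lemma set_facets: "set facets = UNIV"
  unfolding facets_def by (auto intro: facet.exhaust)

definition closure_facets :: "level list \<Rightarrow> facet list" where
  "closure_facets rs = filter (\<lambda>k. list_all (tight k) rs) facets"

text \<open>Several lists may cut out the same face. Keeping those that contain every inequality
  tight on their face leaves one list per nonempty face.\<close>

definition closed_facets :: "facet list list" where
  "closed_facets = filter (\<lambda>ks. closure_facets (face_levels ks) = ks) (subseqs facets)"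

lemma face_of_fundD_imp_level_cone:
  assumes "A face_of fundD" "A \<noteq> {}"
  shows "\<exists>ks\<in>set closed_facets. A = level_cone (set (face_levels ks))"
proof -
  define ks where "ks = filter (\<lambda>k. \<forall>a\<in>A. slack k a = 0) facets"
  have ks: "set ks = {k. \<forall>a\<in>A. slack k a = 0}"
    by (simp add: ks_def set_facets)
  have fin: "finite (UNIV :: facet set)"
    by (metis List.finite_set set_facets)
  have A: "A = level_cone (set (face_levels ks))"
    using face_of_cone_eq[OF fin linear_slack, of A] assms
    unfolding level_cone_face_levels fundD_eq_slack ks by auto
  \<comment> \<open>Being tight on the family and vanishing on \<open>A\<close> agree, so
    \<open>ks\<close> is closed.\<close>
  have "list_all (tight k) (face_levels ks) \<longleftrightarrow> (\<forall>a\<in>A. slack k a = 0)" for k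
  proof
    assume "list_all (tight k) (face_levels ks)"
    then show "\<forall>a\<in>A. slack k a = 0"
      using slack_eq_0_iff face_of_imp_subset[OF assms(1)]
      by (auto simp: A level_cone_def list_all_iff)
  next
    assume "\<forall>a\<in>A. slack k a = 0"
    then show "list_all (tight k) (face_levels ks)"
      by (simp add: list_all_iff mem_face_levels_iff ks)
  qed
  then have "closure_facets (face_levels ks) = ks"
    by (simp add: closure_facets_def ks_def)
  moreover have "ks \<in> set (subseqs facets)"
    unfolding ks_def by (simp add: filter_in_subseqs)
  ultimately show ?thesis
    using A by (auto simp: closed_facets_def)
qed

section \<open>The action of \<open>G\<close> on families of levels\<close>

datatype gen = GA | GB | GC

fun gen_perm :: "gen \<Rightarrow> 6 \<Rightarrow> 6" where
  "gen_perm GA = genA" | "gen_perm GB = genB" | "gen_perm GC = genC"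

fun gen_level :: "gen \<Rightarrow> level \<Rightarrow> level" where
  "gen_level GA (x, y, z, u, v, w) = (x, z, y, v, u, w)"
| "gen_level GB (x, y, z, u, v, w) = (y, x, z, u, w, v)"
| "gen_level GC (x, y, z, u, v, w) = (v, w, z, u, x, y)"

lemma gen_level_gen_level: "gen_level g (gen_level g r) = r"
  by (cases g; cases r) simp_all

lemma gen_perm_gen_perm: "gen_perm g (gen_perm g i) = i"
  using exhaust_6[of i] by (cases g) (auto simp: genA_def genB_def genC_def transpose_def)

lemma level_at_act_gen: "level_at (act (gen_perm g) p) t = gen_level g (level_at p t)"
  by (cases g) (simp_all add: level_at_def act_def genA_def genB_def genC_def transpose_def)

lemma act_comp: "act (\<sigma> \<circ> \<tau>) p = act \<tau> (act \<sigma> p)"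
  by (simp add: act_def)

lemma act_id: "act id = id"
  by (simp add: fun_eq_iff act_def)

lemma act_gen_involution: "act (gen_perm g) (act (gen_perm g) p) = p"
  by (simp add: act_def gen_perm_gen_perm vec_eq_iff)

lemma act_gen_level_cone: "act (gen_perm g) ` level_cone L = level_cone (gen_level g ` L)"
proof -
  have sub: "act (gen_perm g) ` level_cone L \<subseteq> level_cone (gen_level g ` L)" for L
  proof
    fix q assume "q \<in> act (gen_perm g) ` level_cone L"
    then obtain p where p: "q = act (gen_perm g) p" "p \<in> level_cone L"
      by blast
    then have "q \<in> X1"
      by (simp add: X1_def act_def level_cone_def)
    then show "q \<in> level_cone (gen_level g ` L)"
      using p by (simp add: level_cone_def level_at_act_gen)
  qed
  \<comment> \<open>A generator is its own inverse, so \<open>sub\<close> applied to the image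
    family gives the other inclusion.\<close>
  have "level_cone (gen_level g ` L) \<subseteq> act (gen_perm g) ` level_cone L"
  proof
    fix p assume "p \<in> level_cone (gen_level g ` L)"
    then have "act (gen_perm g) p \<in> level_cone (gen_level g ` gen_level g ` L)"
      using sub by blast
    then have "act (gen_perm g) p \<in> level_cone L"
      by (simp add: image_image gen_level_gen_level)
    then show "p \<in> act (gen_perm g) ` level_cone L"
      using act_gen_involution by (metis imageI)
  qed
  with sub show ?thesis
    by blast
qed

text \<open>By \<open>act_comp\<close> permutations act from the right: the head letter is the
  outermost factor of the composition and acts first.\<close>

fun word_level :: "gen list \<Rightarrow> level \<Rightarrow> level" where
  "word_level [] r = r"
| "word_level (g # gs) r = word_level gs (gen_level g r)"

lemma word_level_Nil: "word_level [] = id"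
  by (simp add: fun_eq_iff)

lemma permG_gen_comp: "\<sigma> \<in> permG \<Longrightarrow> gen_perm g \<circ> \<sigma> \<in> permG"
  by (cases g) (simp_all add: permG.stepA permG.stepB permG.stepC)

lemma act_permG_level_cone:
  assumes "\<sigma> \<in> permG"
  shows "\<exists>gs. \<forall>L. act \<sigma> ` level_cone L = level_cone (word_level gs ` L)"
proof -
  have "\<exists>gs. \<forall>L. act (gen_perm g \<circ> \<sigma>) ` level_cone L = level_cone (word_level gs ` L)"
    if ex: "\<exists>gs. \<forall>L. act \<sigma> ` level_cone L = level_cone (word_level gs ` L)" for g \<sigma>
  proof -
    obtain gs where gs: "\<And>L. act \<sigma> ` level_cone L = level_cone (word_level gs ` L)"
      using ex by blast
    have "act (gen_perm g \<circ> \<sigma>) ` level_cone L = level_cone (word_level (g # gs) ` L)" for L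
    proof -
      have "act (gen_perm g \<circ> \<sigma>) ` level_cone L = act \<sigma> ` act (gen_perm g) ` level_cone L"
        by (simp add: act_comp image_image)
      also have "\<dots> = level_cone (word_level (g # gs) ` L)"
        by (simp add: act_gen_level_cone gs image_image)
      finally show ?thesis .
    qed
    then show ?thesis
      by blast
  qed
  note step = this
  from assms show ?thesis
  proof induction
    case id_in
    have "act id ` level_cone L = level_cone (word_level [] ` L)" for L
      by (simp only: act_id word_level_Nil image_id id_apply)
    then show ?case
      by blast
  next
    case (stepA \<sigma>)
    then show ?case
      using step[of \<sigma> GA] by (simp only: gen_perm.simps)
  next
    case (stepB \<sigma>)
    then show ?case
      using step[of \<sigma> GB] by (simp only: gen_perm.simps)
  next
    case (stepC \<sigma>)
    then show ?case
      using step[of \<sigma> GC] by (simp only: gen_perm.simps)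
  qed
qed

text \<open>Turns identifications found by computing with words into elements of
  \<open>permG\<close>.\<close>

lemma word_level_realized: "\<exists>\<sigma>\<in>permG. \<forall>L. act \<sigma> ` level_cone L = level_cone (word_level gs ` L)"
proof (induction gs)
  case Nil
  have "\<forall>L. act id ` level_cone L = level_cone (word_level [] ` L)"
    by (simp only: act_id word_level_Nil image_id id_apply simp_thms)
  then show ?case
    using permG.id_in by blast
next
  case (Cons g gs)
  then obtain \<sigma> where \<sigma>: "\<sigma> \<in> permG" "\<And>L. act \<sigma> ` level_cone L = level_cone (word_level gs ` L)"
    by blast
  have "act (gen_perm g \<circ> \<sigma>) ` level_cone L = act \<sigma> ` act (gen_perm g) ` level_cone L" for L
    by (simp add: act_comp image_image)
  then have "act (gen_perm g \<circ> \<sigma>) ` level_cone L = level_cone (word_level (g # gs) ` L)" for L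
    by (simp add: act_gen_level_cone \<sigma>(2) image_image)
  then show ?case
    using permG_gen_comp[OF \<sigma>(1)] by blast
qed

section \<open>Counting cells\<close>

fun below :: "level \<Rightarrow> level \<Rightarrow> bool" where
  "below (x, y, z, u, v, w) (x', y', z', u', v', w') \<longleftrightarrow>
     (x \<longrightarrow> x') \<and> (y \<longrightarrow> y') \<and> (z \<longrightarrow> z') \<and> (u \<longrightarrow> u') \<and> (v \<longrightarrow> v') \<and> (w \<longrightarrow> w')"

text \<open>On a family listed by increasing size, the greedy chain is a maximal one.\<close>

fun height :: "level list \<Rightarrow> nat" where
  "height [] = 0"
| "height (r # rs) = Suc (height (filter (below r) rs))"

abbreviation face :: "facet list \<Rightarrow> (real^6) set" where
  "face ks \<equiv> level_cone (set (face_levels ks))"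

section \<open>Faces and their dimensions\<close>

lemma face_subset_iff: "face ks \<subseteq> face ks' \<longleftrightarrow> set (face_levels ks) \<subseteq> set (face_levels ks')"
  by (simp add: level_cone_subset_iff no_level_mem_face_levels)

lemma face_eq_iff: "face ks = face ks' \<longleftrightarrow> face_levels ks = face_levels ks'"
proof
  assume "face ks = face ks'"
  then have *: "set (face_levels ks) = set (face_levels ks')"
    by (simp add: level_cone_eq_iff no_level_mem_face_levels)
  \<comment> \<open>All families are sublists of \<open>levels\<close> in its order, so the set
    determines the list.\<close>
  have "face_levels ks = filter (\<lambda>r. r \<in> set (face_levels ks)) levels" for ks
    by (auto simp: face_levels_def intro: filter_cong)
  then show "face_levels ks = face_levels ks'"
    using * by metis
qed simp

lemma face_nonempty: "face ks \<noteq> {}"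
proof
  assume "face ks = {}"
  then have "ray no_level \<notin> face ks"
    by simp
  then show False
    by (simp add: ray_in_level_cone_iff no_level_mem_face_levels)
qed

text \<open>Adding or dropping an inequality can leave the closed lists; this returns to one with
  the same face, so that inductions over closed lists can continue.\<close>

lemma closed_facets_representative: "\<exists>ks'\<in>set closed_facets. face_levels ks' = face_levels ks"
  using face_of_fundD_imp_level_cone[OF level_cone_face_of_fundD face_nonempty] face_eq_iff by metis

lemma aff_dim_face_less:
  assumes "face ks \<subseteq> face ks'" "face_levels ks \<noteq> face_levels ks'"
  shows "aff_dim (face ks) < aff_dim (face ks')"
proof (rule face_of_aff_dim_lt)
  show "convex (face ks')"
    using level_cone_face_of_fundD by (rule face_of_imp_convex)
  show "face ks face_of face ks'"
    using level_cone_face_of_fundD assms(1) face_of_imp_subset[OF level_cone_face_of_fundD]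
    by (rule face_of_subset)
  show "face ks \<noteq> face ks'"
    using assms(2) face_eq_iff by blast
qed

text \<open>Height 1 belongs to the origin. From every other face some extra equation lowers the
  height by exactly one.\<close>

lemma facet_of_face_check:
  "list_all (\<lambda>ks. height (face_levels ks) = 1 \<or>
     list_ex (\<lambda>k. Suc (height (face_levels (k # ks))) = height (face_levels ks)) facets) closed_facets"
  by code_simp

text \<open>Height 7 is the top value, dimension 6. Below it, releasing suitable equations raises
  the height by exactly one.\<close>

lemma cofacet_of_face_check:
  "list_all (\<lambda>ks. height (face_levels ks) = 7 \<or>
     list_ex (\<lambda>ks'. height (face_levels ks') = Suc (height (face_levels ks))) (subseqs ks)) closed_facets"
  by code_simp

text \<open>Descend face by face to the origin: the dimension drops strictly at each of the
  \<open>h\<close> steps and is never negative.\<close>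

lemma aff_dim_face_ge:
  "ks \<in> set closed_facets \<Longrightarrow> height (face_levels ks) = Suc h \<Longrightarrow> int h \<le> aff_dim (face ks)"
proof (induction h arbitrary: ks)
  case 0
  have "aff_dim (face ks) \<noteq> -1"
    using face_nonempty by (simp add: aff_dim_empty)
  then show ?case
    using aff_dim_geq[of "face ks"] by simp
next
  case (Suc h)
  obtain k where k: "height (face_levels (k # ks)) = Suc h"
    using facet_of_face_check Suc.prems by (force simp: list_all_iff list_ex_iff)
  obtain ks' where ks': "ks' \<in> set closed_facets" "face_levels ks' = face_levels (k # ks)"
    using closed_facets_representative by blast
  have "int h \<le> aff_dim (face ks')"
    using Suc.IH[OF ks'(1)] ks'(2) k by simp
  also have "\<dots> < aff_dim (face ks)"
  proof (rule aff_dim_face_less)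
    show "face ks' \<subseteq> face ks"
      by (auto simp: face_subset_iff ks'(2) mem_face_levels_iff)
    show "face_levels ks' \<noteq> face_levels ks"
      using ks'(2) k Suc.prems(2) by auto
  qed
  finally show ?case
    by simp
qed

text \<open>Ascend instead: the dimension grows strictly at each of the \<open>n\<close> steps and
  is bounded by 6.\<close>

lemma aff_dim_face_le:
  "ks \<in> set closed_facets \<Longrightarrow> height (face_levels ks) + n = 7 \<Longrightarrow> aff_dim (face ks) + int n \<le> 6"
proof (induction n arbitrary: ks)
  case 0
  show ?case
    using aff_dim_le_DIM[of "face ks"] by simp
next
  case (Suc n)
  obtain ks0 where ks0: "ks0 \<in> set (subseqs ks)" "height (face_levels ks0) = Suc (height (face_levels ks))"
    using cofacet_of_face_check Suc.prems by (force simp: list_all_iff list_ex_iff)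
  then have sub: "set ks0 \<subseteq> set ks"
    using subseqs_powset by (metis PowD image_eqI)
  obtain ks' where ks': "ks' \<in> set closed_facets" "face_levels ks' = face_levels ks0"
    using closed_facets_representative by blast
  have "aff_dim (face ks') + int n \<le> 6"
    using Suc.IH[OF ks'(1)] ks'(2) ks0 Suc.prems by simp
  moreover have "aff_dim (face ks) < aff_dim (face ks')"
  proof (rule aff_dim_face_less)
    show "face ks \<subseteq> face ks'"
      unfolding face_subset_iff ks'(2) using sub mem_face_levels_iff by blast
    show "face_levels ks \<noteq> face_levels ks'"
      using ks'(2) ks0(2) by auto
  qed
  ultimately show ?case
    by simp
qed

text \<open>The two chains meet. The chain counted by \<open>height\<close> includes
  \<open>no_level\<close>, the origin, which accounts for the \<open>+ 1\<close>.\<close>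

lemma aff_dim_face:
  assumes "ks \<in> set closed_facets"
  shows "int (height (face_levels ks)) = aff_dim (face ks) + 1"
proof -
  have "no_level \<in> set (face_levels ks)"
    by (rule no_level_mem_face_levels)
  then obtain h where h: "height (face_levels ks) = Suc h"
    by (cases "face_levels ks") auto
  have ge: "int h \<le> aff_dim (face ks)"
    using aff_dim_face_ge[OF assms h] .
  moreover have "aff_dim (face ks) \<le> 6"
    using aff_dim_le_DIM[of "face ks"] by simp
  ultimately have "height (face_levels ks) + (6 - h) = 7"
    using h by simp
  then have "aff_dim (face ks) + int (6 - h) \<le> 6"
    by (rule aff_dim_face_le[OF assms])
  with ge h show ?thesis
    by simp
qed

lemma faces_of_dim_eq:
  "faces_of_dim d = face ` set (filter (\<lambda>ks. height (face_levels ks) = Suc d) closed_facets)"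
proof -
  \<comment> \<open>The empty face has dimension -1, so it is never counted.\<close>
  have "A \<noteq> {}" if "aff_dim A = int d" for A :: "(real^6) set"
    using that by auto
  then show ?thesis
    unfolding faces_of_dim_def
    using level_cone_face_of_fundD face_of_fundD_imp_level_cone aff_dim_face
    by (force simp: image_iff)
qed

text \<open>\<open>G\<close> permutes the triples \<open>{x, y, z}\<close>, \<open>{x, u, v}\<close>, \<open>{y, u, w}\<close>, \<open>{z, v, w}\<close>. The summand \<open>1\<close> and
  the cubes are chosen by trial so that the resulting invariant separates the orbits of all faces,
  of whatever dimension.\<close>

fun triangle_weights :: "level \<Rightarrow> int list" where
  "triangle_weights (x, y, z, u, v, w) =
     [1 + of_bool x + of_bool y + of_bool z, 1 + of_bool x + of_bool u + of_bool v,
      1 + of_bool y + of_bool u + of_bool w, 1 + of_bool z + of_bool v + of_bool w]"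

fun cube :: "int \<Rightarrow> int" where
  "cube a = a * a * a"

definition triangle_invariant :: "level list \<Rightarrow> int" where
  "triangle_invariant rs = (\<Sum>i\<leftarrow>[0, 1, 2, 3]. cube (\<Sum>r\<leftarrow>rs. triangle_weights r ! i))"

definition triangle_invariant_set :: "level set \<Rightarrow> int" where
  "triangle_invariant_set L = (\<Sum>i\<leftarrow>[0, 1, 2, 3]. cube (\<Sum>r\<in>L. triangle_weights r ! i))"

lemma triangle_invariant_eq: "distinct rs \<Longrightarrow> triangle_invariant rs = triangle_invariant_set (set rs)"
  by (simp add: triangle_invariant_def triangle_invariant_set_def sum_list_distinct_conv_sum_set)

text \<open>Each generator swaps two of the four triangle sums, and the sum of cubes is symmetric in
  them.\<close>

lemma triangle_invariant_set_gen: "triangle_invariant_set (gen_level g ` L) = triangle_invariant_set L"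
proof -
  have inj: "inj_on (gen_level g) L"
    by (metis gen_level_gen_level inj_onI)
  have *: "triangle_weights (gen_level g r) =
    (let t = triangle_weights r in case g of
       GA \<Rightarrow> [t ! 0, t ! 1, t ! 3, t ! 2] | GB \<Rightarrow> [t ! 0, t ! 2, t ! 1, t ! 3] | GC \<Rightarrow> [t ! 3, t ! 1, t ! 2, t ! 0])" for r
    by (cases g; cases r) (simp_all add: algebra_simps)
  show ?thesis
    unfolding triangle_invariant_set_def sum.reindex[OF inj] o_def *
    by (cases g) (simp_all add: Let_def)
qed

lemma triangle_invariant_set_word: "triangle_invariant_set (word_level gs ` L) = triangle_invariant_set L"
proof (induction gs arbitrary: L)
  case (Cons g gs)
  have "word_level (g # gs) ` L = word_level gs ` gen_level g ` L"
    by (simp add: image_image)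
  then show ?case
    by (simp only: Cons.IH triangle_invariant_set_gen)
qed (simp add: word_level_Nil)

text \<open>Executable form of the statement that the word carries one family onto the other, split
  into two inclusions.\<close>

definition word_maps :: "gen list \<Rightarrow> level list \<Rightarrow> level list \<Rightarrow> bool" where
  "word_maps gs rs rs' \<longleftrightarrow> list_all (\<lambda>r. word_level gs r \<in> set rs') rs
     \<and> list_all (\<lambda>r. r \<in> set (map (word_level gs) rs)) rs'"

text \<open>The stabilizer of the honeycomb cone, generated by \<open>genA\<close> and \<open>genB\<close>, already realizes all identifications.\<close>

definition connected_by_word :: "level list \<Rightarrow> level list \<Rightarrow> bool" where
  "connected_by_word rs rs' \<longleftrightarrow>
     list_ex (\<lambda>gs. word_maps gs rs rs') [[], [GA], [GB], [GA, GB, GA], [GA, GB], [GB, GA]]"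

definition separated_by :: "(level list \<times> int) list \<Rightarrow> bool" where
  "separated_by ps \<longleftrightarrow>
     list_all (\<lambda>(rs, a). list_all (\<lambda>(rs', b). a \<noteq> b \<or> connected_by_word rs rs') ps) ps"

text \<open>Completeness of the invariant by finite computation: faces with equal values are related
  by one of the six words.\<close>

lemma separated_check:
  "separated_by (map (\<lambda>ks. (face_levels ks, triangle_invariant (face_levels ks))) closed_facets)"
  by code_simp

lemma distinct_face_levels: "distinct (face_levels ks)"
proof -
  have "distinct levels"
    by code_simp
  then show ?thesis
    by (simp add: face_levels_def)
qed

lemma face_ident_iff:
  assumes "ks \<in> set closed_facets" "ks' \<in> set closed_facets"
  shows "(face ks, face ks') \<in> face_ident \<longleftrightarrow>
    triangle_invariant (face_levels ks) = triangle_invariant (face_levels ks')"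
proof
  assume "(face ks, face ks') \<in> face_ident"
  then obtain \<sigma> \<tau> where \<sigma>\<tau>: "\<sigma> \<in> permG" "\<tau> \<in> permG" "act \<sigma> ` face ks = act \<tau> ` face ks'"
    by (auto simp: face_ident_def)
  obtain gs where gs: "\<And>L. act \<sigma> ` level_cone L = level_cone (word_level gs ` L)"
    using act_permG_level_cone[OF \<sigma>\<tau>(1)] by blast
  obtain gs' where gs': "\<And>L. act \<tau> ` level_cone L = level_cone (word_level gs' ` L)"
    using act_permG_level_cone[OF \<sigma>\<tau>(2)] by blast
  \<comment> \<open>Images of families still contain \<open>no_level\<close>, so equality of the
    image cones gives equality of the image families.\<close>
  have "word_level gs no_level = no_level" for gs
  proof (induction gs)
    case (Cons g gs)
    then show ?case
      by (cases g) (simp_all add: no_level_def)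
  qed simp
  then have mem: "no_level \<in> word_level gs ` set (face_levels ks)" for gs ks
    using no_level_mem_face_levels by (metis image_eqI)
  have "word_level gs ` set (face_levels ks) = word_level gs' ` set (face_levels ks')"
    using \<sigma>\<tau>(3) unfolding gs gs' level_cone_eq_iff[OF mem mem] .
  then have "triangle_invariant_set (set (face_levels ks)) = triangle_invariant_set (set (face_levels ks'))"
    by (metis triangle_invariant_set_word)
  then show "triangle_invariant (face_levels ks) = triangle_invariant (face_levels ks')"
    by (simp add: triangle_invariant_eq distinct_face_levels)
next
  assume "triangle_invariant (face_levels ks) = triangle_invariant (face_levels ks')"
  then have "connected_by_word (face_levels ks) (face_levels ks')"
    using separated_check assms unfolding separated_by_def list_all_iff by auto
  then obtain gs where "word_maps gs (face_levels ks) (face_levels ks')"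
    by (auto simp: connected_by_word_def)
  then have eq: "word_level gs ` set (face_levels ks) = set (face_levels ks')"
    by (auto simp: word_maps_def list_all_iff)
  obtain \<sigma> where "\<sigma> \<in> permG" "\<And>L. act \<sigma> ` level_cone L = level_cone (word_level gs ` L)"
    using word_level_realized[of gs] by blast
  then have "\<sigma> \<in> permG" "act \<sigma> ` face ks = act id ` face ks'"
    by (simp_all only: eq act_id image_id id_apply)
  then show "(face ks, face ks') \<in> face_ident"
    using level_cone_face_of_fundD permG.id_in unfolding face_ident_def by blast
qed

text \<open>The class of a face is the fibre of the invariant over its value, so classes are counted
  by the distinct values attained in dimension \<open>d\<close>.\<close>

lemma num_cells_eq:
  "num_cells d = length (remdups (map (\<lambda>ks. triangle_invariant (face_levels ks))
     (filter (\<lambda>ks. height (face_levels ks) = Suc d) closed_facets)))"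
proof -
  define tinv where "tinv = (\<lambda>ks. triangle_invariant (face_levels ks))"
  define cells where "cells = set (filter (\<lambda>ks. height (face_levels ks) = Suc d) closed_facets)"
  \<comment> \<open>The fibre runs over faces of every dimension, since \<open>face_ident\<close>
    does not restrict the second face.\<close>
  define cls where "cls = (\<lambda>a. face ` {ks \<in> set closed_facets. tinv ks = a})"
  have cells: "ks \<in> set closed_facets" if "ks \<in> cells" for ks
    using that by (simp add: cells_def)
  have "face_ident `` {face ks} = cls (tinv ks)" if ks: "ks \<in> set closed_facets" for ks
  proof
    show "face_ident `` {face ks} \<subseteq> cls (tinv ks)"
    proof
      fix B assume "B \<in> face_ident `` {face ks}"
      then have B: "(face ks, B) \<in> face_ident"
        by simp
      then have "B face_of fundD" "B \<noteq> {}"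
        using face_nonempty[of ks] by (auto simp: face_ident_def)
      then obtain ks' where ks': "ks' \<in> set closed_facets" "B = face ks'"
        using face_of_fundD_imp_level_cone by blast
      then have "tinv ks' = tinv ks"
        using B face_ident_iff[OF ks ks'(1)] by (simp add: tinv_def)
      then show "B \<in> cls (tinv ks)"
        using ks' by (simp add: cls_def)
    qed
    show "cls (tinv ks) \<subseteq> face_ident `` {face ks}"
    proof
      fix B assume "B \<in> cls (tinv ks)"
      then obtain ks' where ks': "ks' \<in> set closed_facets" "tinv ks' = tinv ks" "B = face ks'"
        by (auto simp: cls_def)
      then show "B \<in> face_ident `` {face ks}"
        using face_ident_iff[OF ks ks'(1)] by (simp add: tinv_def)
    qed
  qed
  then have "faces_of_dim d // face_ident = cls ` tinv ` cells"
    unfolding faces_of_dim_eq quotient_def cells_def[symmetric] using cells by auto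
  moreover have "inj_on cls (tinv ` cells)"
  proof (rule inj_onI)
    fix a b assume a: "a \<in> tinv ` cells" and ab: "cls a = cls b"
    from a obtain ks where ks: "ks \<in> cells" "a = tinv ks"
      by blast
    then have "face ks \<in> cls b"
      unfolding ab[symmetric] using cells by (simp add: cls_def)
    then obtain ks' where "face ks = face ks'" "tinv ks' = b"
      by (auto simp: cls_def)
    then show "a = b"
      by (auto simp: ks(2) face_eq_iff tinv_def)
  qed
  ultimately have "num_cells d = card (tinv ` cells)"
    by (simp add: num_cells_def card_image)
  then show ?thesis
    by (simp add: tinv_def cells_def length_remdups_card_conv)
qed

lemma num_cells_values: "map num_cells [1, 2, 3, 4, 5] = [7, 18, 25, 21, 8]"
  unfolding num_cells_eq list.map by code_simp

section \<open>Contractibility of the link\<close>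

lemma istopology_quotient:
  "istopology (\<lambda>U. U \<subseteq> f ` topspace X \<and> openin X {x \<in> topspace X. f x \<in> U})"
proof -
  have 1: "{x \<in> topspace X. f x \<in> S \<inter> T} = {x \<in> topspace X. f x \<in> S} \<inter> {x \<in> topspace X. f x \<in> T}" for S T
    by auto
  have 2: "{x \<in> topspace X. f x \<in> \<Union>K} = (\<Union>S\<in>K. {x \<in> topspace X. f x \<in> S})" for K
    by auto
  show ?thesis
    unfolding istopology_def 1 2 by (auto intro!: openin_Union)
qed

lemma openin_quotient_topology:
  "openin (quotient_topology X f) U \<longleftrightarrow> U \<subseteq> f ` topspace X \<and> openin X {x \<in> topspace X. f x \<in> U}"
  unfolding quotient_topology_def by (subst topology_inverse'[OF istopology_quotient]) simp

lemma topspace_quotient_topology: "topspace (quotient_topology X f) = f ` topspace X"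
proof
  show "topspace (quotient_topology X f) \<subseteq> f ` topspace X"
    using openin_quotient_topology[of X f "topspace (quotient_topology X f)"] by simp
  have "{x \<in> topspace X. f x \<in> f ` topspace X} = topspace X"
    by auto
  then have "openin (quotient_topology X f) (f ` topspace X)"
    by (simp add: openin_quotient_topology)
  then show "f ` topspace X \<subseteq> topspace (quotient_topology X f)"
    by (rule openin_subset)
qed

lemma quotient_map_quotient_topology: "quotient_map X (quotient_topology X f) f"
  by (auto simp: quotient_map_def topspace_quotient_topology openin_quotient_topology)

lemma open_map_id_prod:
  assumes "open_map X Y f"
  shows "open_map (prod_topology Z X) (prod_topology Z Y) (\<lambda>(z, x). (z, f x))"
  unfolding open_map_def
proof (intro allI impI)
  fix W assume W: "openin (prod_topology Z X) W"
  show "openin (prod_topology Z Y) ((\<lambda>(z, x). (z, f x)) ` W)"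
    unfolding openin_prod_topology_alt
  proof (intro allI impI)
    fix z y assume "(z, y) \<in> (\<lambda>(z, x). (z, f x)) ` W"
    then obtain x where x: "(z, x) \<in> W" "y = f x"
      by auto
    with W[unfolded openin_prod_topology_alt, rule_format, OF x(1)]
    obtain A B where AB: "openin Z A" "openin X B" "z \<in> A" "x \<in> B" "A \<times> B \<subseteq> W"
      by blast
    have "openin Y (f ` B)"
      using assms AB(2) by (simp add: open_map_def)
    moreover have "A \<times> f ` B \<subseteq> (\<lambda>(z, x). (z, f x)) ` W"
      using AB(5) by force
    ultimately show "\<exists>U V. openin Z U \<and> openin Y V \<and> z \<in> U \<and> y \<in> V \<and> U \<times> V \<subseteq> (\<lambda>(z, x). (z, f x)) ` W"
      using AB(1,3,4) x(2) by blast
  qed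
qed

text \<open>Openness of \<open>q\<close> makes \<open>id \<times> q\<close> a quotient map, so that the contraction descends.\<close>

lemma contractible_space_open_quotient:
  assumes q: "quotient_map X Y q" "open_map X Y q"
    and h: "continuous_map (prod_topology (top_of_set {0..1}) X) X h"
    and h0: "\<And>x. x \<in> topspace X \<Longrightarrow> h (0::real, x) = x"
    and h1: "\<And>x. x \<in> topspace X \<Longrightarrow> h (1, x) = c"
    and compat: "\<And>t x x'. t \<in> {0..1} \<Longrightarrow> x \<in> topspace X \<Longrightarrow> x' \<in> topspace X \<Longrightarrow> q x = q x' \<Longrightarrow> q (h (t, x)) = q (h (t, x'))"
  shows "contractible_space Y"
proof -
  \<comment> \<open>An arbitrary section of \<open>q\<close>, with no continuity. By
    \<open>compat\<close> the map \<open>k\<close> does not depend on it, and \<open>k\<close>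
    composed with \<open>id \<times> q\<close> equals \<open>q \<circ> h\<close>.\<close>
  define s where "s = inv_into (topspace X) q"
  define k where "k = (\<lambda>(t, y). q (h (t, s y)))"
  have surj: "q ` topspace X = topspace Y"
    using q(1) by (rule quotient_imp_surjective_map)
  have s: "s y \<in> topspace X" "q (s y) = y" if "y \<in> topspace Y" for y
    using that surj unfolding s_def by (auto intro: inv_into_into f_inv_into_f)
  let ?I = "top_of_set {0..1::real}"
  have quot: "quotient_map (prod_topology ?I X) (prod_topology ?I Y) (\<lambda>(t, x). (t, q x))"
  proof (rule continuous_open_imp_quotient_map)
    show "continuous_map (prod_topology ?I X) (prod_topology ?I Y) (\<lambda>(t, x). (t, q x))"
      using quotient_imp_continuous_map[OF q(1)]
      by (auto simp: case_prod_unfold intro!: continuous_map_pairedI continuous_map_fst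
          continuous_map_compose[OF continuous_map_snd, unfolded o_def])
    show "open_map (prod_topology ?I X) (prod_topology ?I Y) (\<lambda>(t, x). (t, q x))"
      using q(2) by (rule open_map_id_prod)
    show "(\<lambda>(t, x). (t, q x)) ` topspace (prod_topology ?I X) = topspace (prod_topology ?I Y)"
      using surj by force
  qed
  have "continuous_map (prod_topology ?I X) Y (k \<circ> (\<lambda>(t, x). (t, q x)))"
  proof (rule continuous_map_eq)
    show "continuous_map (prod_topology ?I X) Y (q \<circ> h)"
      using h quotient_imp_continuous_map[OF q(1)] by (rule continuous_map_compose)
    fix z assume "z \<in> topspace (prod_topology ?I X)"
    then obtain t x where z: "z = (t, x)" "t \<in> {0..1}" "x \<in> topspace X"
      by auto
    then have "q x \<in> topspace Y"
      using surj by blast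
    then show "(q \<circ> h) z = (k \<circ> (\<lambda>(t, x). (t, q x))) z"
      using z s by (auto simp: k_def intro!: compat)
  qed
  then have k: "continuous_map (prod_topology ?I Y) Y k"
    using quot by (rule continuous_compose_quotient_map[rotated])
  have "homotopic_with (\<lambda>_. True) Y Y id (\<lambda>_. q c)"
    by (subst homotopic_with) (use k s h0 h1 in \<open>auto simp: k_def intro!: exI[of _ k]\<close>)
  then show ?thesis
    unfolding contractible_space_def by blast
qed

section \<open>Orbits and the sweep\<close>

lemma permG_comp: "\<sigma> \<in> permG \<Longrightarrow> \<tau> \<in> permG \<Longrightarrow> \<sigma> \<circ> \<tau> \<in> permG"
  by (induction rule: permG.induct) (simp_all add: comp_assoc permG.stepA permG.stepB permG.stepC)

text \<open>Generators are involutions, so a new left factor is undone by the same generator placed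
  on the right of the inverse.\<close>

lemma permG_inverse: "\<sigma> \<in> permG \<Longrightarrow> \<exists>\<tau>\<in>permG. \<sigma> \<circ> \<tau> = id \<and> \<tau> \<circ> \<sigma> = id"
proof (induction rule: permG.induct)
  case id_in
  have "id \<circ> id = id"
    by (rule id_comp)
  then show ?case
    using permG.id_in by blast
next
  have step: "\<exists>\<tau>\<in>permG. (gen_perm g \<circ> \<sigma>) \<circ> \<tau> = id \<and> \<tau> \<circ> (gen_perm g \<circ> \<sigma>) = id"
    if ex: "\<exists>\<tau>\<in>permG. \<sigma> \<circ> \<tau> = id \<and> \<tau> \<circ> \<sigma> = id" for g \<sigma>
  proof -
    obtain \<tau> where \<tau>: "\<tau> \<in> permG" "\<sigma> \<circ> \<tau> = id" "\<tau> \<circ> \<sigma> = id"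
      using ex by blast
    have "gen_perm g \<in> permG"
      using permG_gen_comp[OF permG.id_in, of g] by simp
    then have "\<tau> \<circ> gen_perm g \<in> permG"
      by (rule permG_comp[OF \<tau>(1)])
    moreover have "(gen_perm g \<circ> \<sigma>) \<circ> (\<tau> \<circ> gen_perm g) = id"
      using \<tau>(2) by (simp add: fun_eq_iff gen_perm_gen_perm)
    moreover have "(\<tau> \<circ> gen_perm g) \<circ> (gen_perm g \<circ> \<sigma>) = id"
      using \<tau>(3) by (simp add: fun_eq_iff gen_perm_gen_perm)
    ultimately show ?thesis
      by blast
  qed
  {
    case (stepA \<sigma>)
    then show ?case
      using step[of \<sigma> GA] by (simp only: gen_perm.simps)
  next
    case (stepB \<sigma>)
    then show ?case
      using step[of \<sigma> GB] by (simp only: gen_perm.simps)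
  next
    case (stepC \<sigma>)
    then show ?case
      using step[of \<sigma> GC] by (simp only: gen_perm.simps)
  }
qed

lemma orbitG_eq_iff: "orbitG p = orbitG p' \<longleftrightarrow> (\<exists>\<sigma>\<in>permG. p' = act \<sigma> p)"
proof
  assume "orbitG p = orbitG p'"
  moreover have "p' \<in> orbitG p'"
    unfolding orbitG_def using permG.id_in act_id by (metis (mono_tags, lifting) id_apply mem_Collect_eq)
  ultimately show "\<exists>\<sigma>\<in>permG. p' = act \<sigma> p"
    by (auto simp: orbitG_def)
next
  have sub: "orbitG (act \<sigma> p) \<subseteq> orbitG p" if "\<sigma> \<in> permG" for \<sigma> p
    using permG_comp[OF that] by (force simp: orbitG_def simp flip: act_comp)
  assume "\<exists>\<sigma>\<in>permG. p' = act \<sigma> p"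
  then obtain \<sigma> where \<sigma>: "\<sigma> \<in> permG" "p' = act \<sigma> p"
    by blast
  then obtain \<tau> where \<tau>: "\<tau> \<in> permG" "\<sigma> \<circ> \<tau> = id"
    using permG_inverse by blast
  have "act \<tau> p' = p"
    using \<tau>(2) by (simp add: \<sigma>(2) act_id flip: act_comp)
  then show "orbitG p = orbitG p'"
    using sub[OF \<sigma>(1), of p] sub[OF \<tau>(1), of p'] \<sigma>(2) by auto
qed

abbreviation sweep_link :: "(real^6) set" where
  "sweep_link \<equiv> sweepP \<inter> {p. (\<Sum>i\<in>UNIV. p $ i) = 1}"

lemma continuous_on_act: "continuous_on S (act \<sigma>)"
  unfolding act_def by (intro continuous_on_vec_lambda continuous_intros)

lemma act_mem_sweep_link:
  assumes "\<sigma> \<in> permG" "p \<in> sweep_link"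
  shows "act \<sigma> p \<in> sweep_link"
proof -
  obtain \<tau> r where r: "\<tau> \<in> permG" "r \<in> honeycombP" "p = act \<tau> r"
    using assms(2) by (auto simp: sweepP_def)
  have "act \<sigma> p = act (\<tau> \<circ> \<sigma>) r"
    by (simp add: r(3) act_comp)
  then have "act \<sigma> p \<in> sweepP"
    using permG_comp[OF r(1) assms(1)] r(2) by (auto simp: sweepP_def)
  moreover have "bij \<sigma>"
    using permG_inverse[OF assms(1)] o_bij by blast
  then have "(\<Sum>i\<in>UNIV. act \<sigma> p $ i) = (\<Sum>i\<in>UNIV. p $ i)"
    unfolding act_def by (simp add: sum.reindex_bij_betw[of \<sigma> UNIV UNIV "\<lambda>i. p $ i"])
  ultimately show ?thesis
    using assms(2) by simp
qed

text \<open>The saturation of an open set is the union of its preimages under the group elements,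
  each of which maps the link continuously to itself.\<close>

lemma open_map_orbitG: "open_map (top_of_set sweep_link) link_space orbitG"
  unfolding open_map_def link_space_def openin_quotient_topology
proof (intro allI impI conjI)
  fix U assume U: "openin (top_of_set sweep_link) U"
  then have sub: "U \<subseteq> sweep_link"
    using openin_subset by fastforce
  show "orbitG ` U \<subseteq> orbitG ` topspace (top_of_set sweep_link)"
    using sub by auto
  have eq: "{p \<in> topspace (top_of_set sweep_link). orbitG p \<in> orbitG ` U}
    = (\<Union>\<sigma>\<in>permG. sweep_link \<inter> act \<sigma> -` U)" (is "_ = ?V")
  proof
    show "{p \<in> topspace (top_of_set sweep_link). orbitG p \<in> orbitG ` U} \<subseteq> ?V"
    proof
      fix p assume p: "p \<in> {p \<in> topspace (top_of_set sweep_link). orbitG p \<in> orbitG ` U}"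
      then obtain p' where "p' \<in> U" "orbitG p = orbitG p'"
        by auto
      then obtain \<sigma> where "\<sigma> \<in> permG" "act \<sigma> p \<in> U"
        by (auto simp: orbitG_eq_iff)
      then show "p \<in> ?V"
        using p by auto
    qed
    show "?V \<subseteq> {p \<in> topspace (top_of_set sweep_link). orbitG p \<in> orbitG ` U}"
    proof
      fix p assume "p \<in> ?V"
      then obtain \<sigma> where \<sigma>: "\<sigma> \<in> permG" "act \<sigma> p \<in> U" "p \<in> sweep_link"
        by blast
      then have "orbitG p = orbitG (act \<sigma> p)"
        by (auto simp: orbitG_eq_iff)
      then show "p \<in> {p \<in> topspace (top_of_set sweep_link). orbitG p \<in> orbitG ` U}"
        using \<sigma> by simp
    qed
  qed
  have preimage: "openin (top_of_set sweep_link) (sweep_link \<inter> act \<sigma> -` U)" if "\<sigma> \<in> permG" for \<sigma>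
    using continuous_on_act _ U
  proof (rule continuous_openin_preimage)
    show "act \<sigma> \<in> sweep_link \<rightarrow> sweep_link"
      using act_mem_sweep_link[OF that] by blast
  qed
  have "openin (top_of_set sweep_link) ?V"
    by (rule openin_Union) (use preimage in blast)
  then show "openin (top_of_set sweep_link) {p \<in> topspace (top_of_set sweep_link). orbitG p \<in> orbitG ` U}"
    unfolding eq .
qed

text \<open>The honeycomb cone is convex and contains the \<open>G\<close>-fixed ray through \<open>(1, \<dots>, 1)\<close>, so the sweep is
  star-shaped about that ray, by a contraction that commutes with \<open>G\<close>.\<close>

lemma honeycombP_convex_combination:
  assumes "p \<in> honeycombP" "0 \<le> t" "t \<le> 1"
  shows "(1 - t) *\<^sub>R p + t *\<^sub>R vec (1 / 6) \<in> honeycombP"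
proof -
  have *: "(1 - t) * a \<le> (1 - t) * b" if "a \<le> b" for a b
    using that assms(3) by (simp add: mult_left_mono)
  show ?thesis
    using assms * by (auto simp: honeycombP_def X1_def)
qed

lemma act_convex_combination:
  "act \<sigma> ((1 - t) *\<^sub>R p + t *\<^sub>R vec a) = (1 - t) *\<^sub>R act \<sigma> p + t *\<^sub>R vec a"
  by (simp add: act_def vec_eq_iff)

text \<open>The point with all coordinates 1/6 is where the fixed ray meets the hyperplane, so the
  coordinate sum stays 1. Moving inside the honeycomb cone and then permuting stays in the
  sweep.\<close>

lemma sweep_link_convex_combination:
  assumes "p \<in> sweep_link" "t \<in> {0..1}"
  shows "(1 - t) *\<^sub>R p + t *\<^sub>R vec (1 / 6) \<in> sweep_link"
proof -
  obtain \<tau> r where r: "\<tau> \<in> permG" "r \<in> honeycombP" "p = act \<tau> r"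
    using assms(1) by (auto simp: sweepP_def)
  have "(1 - t) *\<^sub>R p + t *\<^sub>R vec (1 / 6) \<in> sweepP"
    using honeycombP_convex_combination[OF r(2)] assms(2) r(1)
    by (auto simp: r(3) sweepP_def simp flip: act_convex_combination)
  moreover have "(\<Sum>i\<in>UNIV. ((1 - t) *\<^sub>R p + t *\<^sub>R vec (1 / 6) :: real^6) $ i) = 1"
    using assms(1) by (simp add: sum.distrib flip: sum_distrib_left)
  ultimately show ?thesis
    by simp
qed

lemma contractible_link_space: "contractible_space link_space"
proof (rule contractible_space_open_quotient)
  let ?h = "\<lambda>(t::real, p). (1 - t) *\<^sub>R p + t *\<^sub>R vec (1 / 6) :: real^6"
  show "quotient_map (top_of_set sweep_link) link_space orbitG"
    unfolding link_space_def by (rule quotient_map_quotient_topology)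
  show "open_map (top_of_set sweep_link) link_space orbitG"
    by (rule open_map_orbitG)
  have "continuous_on ({0..1} \<times> sweep_link) ?h"
    unfolding case_prod_unfold by (intro continuous_intros)
  moreover have "?h ` ({0..1} \<times> sweep_link) \<subseteq> sweep_link"
    using sweep_link_convex_combination by auto
  ultimately show "continuous_map (prod_topology (top_of_set {0..1}) (top_of_set sweep_link)) (top_of_set sweep_link) ?h"
    by (auto simp: prod_topology_subtopology_eu)
  show "?h (1, p) = vec (1 / 6)" for p
    by simp
  show "orbitG (?h (t, p)) = orbitG (?h (t, p'))" if "orbitG p = orbitG p'" for t p p'
    using that by (auto simp: orbitG_eq_iff act_convex_combination)
qed simp

lemma trivial_link_homology: "trivial_group (reduced_homology_group p link_space)"
  by (rule trivial_reduced_homology_group_contractible_space[OF contractible_link_space])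

theorem mainTheorem7:
  shows "num_cells 1 = 7 \<and> num_cells 2 = 18 \<and> num_cells 3 = 25 \<and> num_cells 4 = 21
         \<and> num_cells 5 = 8
         \<and> (\<forall>p::int. trivial_group (reduced_homology_group p link_space))"
  using num_cells_values trivial_link_homology by simp

end
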